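(* GreedyAlgoForDDP is a polynomial-time approximation algorithm for DDP: it outputs a partition of the deliveries into feasible assignments using at most $2\,\mathrm{OPT}+(\Delta+1)$ drones, where $\mathrm{OPT}$ is the optimum number of drones for the instance and $\Delta$ is the maximum degree of the interval graph $G$ of the delivery time intervals.
   Context: DDP instance: deliveries $j=1,\dots,n$, each with a closed delivery time interval $I_j=[t_j^L,t_j^R]$ and cost $0<c_j\le B$, where $B>0$ is the battery budget of identical drones. A set of intervals is feasible if the intervals are pairwise disjoint and their total cost is at most $B$. DDP asks for the minimum number $\mathrm{OPT}$ of drones such that the deliveries can be partitioned into that many feasible sets. The interval graph $G$ has one vertex per interval and an edge between two vertices iff the intervals intersect. GreedyAlgoForDDP: sort the deliveries by non-decreasing $t_j^L$; process them in this order; assign the current delivery $j$ to an already opened drone whose current assignment together with $I_j$ is feasible, choosing one with maximum remaining capacity; if none exists, open a new drone and assign $j$ to it. *)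

theory Defs
  imports
    Complex_Main
    "HOL-Library.Disjoint_Sets"
    "HOL-Library.Monad_Syntax"
    "HOL-Computational_Algebra.Polynomial"
begin

section \<open>The drone delivery problem\<close>

record delivery =
  tL :: real
  tR :: real
  cost :: real

text \<open>
  The deliveries of an instance are numbered \<open>0, \<dots>, n - 1\<close> by their position in the list. Distinct
  deliveries may have the same interval and the same cost.
\<close>

record ddp =
  deliveries :: "delivery list"
  budget :: real

definition ddp_instance :: "ddp \<Rightarrow> bool" where
  "ddp_instance X \<longleftrightarrow> 0 < budget X \<and>
     (\<forall>d\<in>set (deliveries X). tL d \<le> tR d \<and> 0 < cost d \<and> cost d \<le> budget X)"

definition num_deliveries :: "ddp \<Rightarrow> nat" where
  "num_deliveries X = length (deliveries X)"

definition interval :: "ddp \<Rightarrow> nat \<Rightarrow> real set" where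
  "interval X j = {tL (deliveries X ! j) .. tR (deliveries X ! j)}"

definition total_cost :: "ddp \<Rightarrow> nat set \<Rightarrow> real" where
  "total_cost X A = (\<Sum>j\<in>A. cost (deliveries X ! j))"

definition feasible :: "ddp \<Rightarrow> nat set \<Rightarrow> bool" where
  "feasible X A \<longleftrightarrow> disjoint_family_on (interval X) A \<and> total_cost X A \<le> budget X"

definition feasible_partition :: "ddp \<Rightarrow> nat set set \<Rightarrow> bool" where
  "feasible_partition X P \<longleftrightarrow> partition_on {..<num_deliveries X} P \<and> (\<forall>A\<in>P. feasible X A)"

definition OPT :: "ddp \<Rightarrow> nat" where
  "OPT X = (LEAST k. \<exists>P. feasible_partition X P \<and> card P = k)"

section \<open>The interval graph\<close>

text \<open>A graph is a pair of a vertex set and a set of two-element edges.\<close>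

definition interval_graph :: "ddp \<Rightarrow> nat set \<times> nat set set" where
  "interval_graph X =
     ({..<num_deliveries X},
      {{i, j} | i j. i < num_deliveries X \<and> j < num_deliveries X \<and> i \<noteq> j \<and>
                     interval X i \<inter> interval X j \<noteq> {}})"

definition vertex_degree :: "'v set \<times> 'v set set \<Rightarrow> 'v \<Rightarrow> nat" where
  "vertex_degree G v = card {e \<in> snd G. v \<in> e}"

text \<open>The element \<open>0\<close> only matters for the graph without vertices.\<close>

definition max_degree :: "'v set \<times> 'v set set \<Rightarrow> nat" where
  "max_degree G = Max (insert 0 (vertex_degree G ` fst G))"

section \<open>The greedy algorithm\<close>

text \<open>
  Ties, both in the sorting and among the drones of maximum remaining capacity, may be broken
  arbitrarily, so the algorithm is a relation between instances and outputs. The state is the list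
  of the opened drones, each given by the set of the deliveries assigned to it.
\<close>

definition remaining_capacity :: "ddp \<Rightarrow> nat set \<Rightarrow> real" where
  "remaining_capacity X A = budget X - total_cost X A"

inductive greedy_step :: "ddp \<Rightarrow> nat \<Rightarrow> nat set list \<Rightarrow> nat set list \<Rightarrow> bool"
  for X :: ddp and j :: nat and D :: "nat set list" where
  assign_drone:
    "\<lbrakk>k < length D; feasible X (insert j (D ! k));
      \<And>l. \<lbrakk>l < length D; feasible X (insert j (D ! l))\<rbrakk>
        \<Longrightarrow> remaining_capacity X (D ! l) \<le> remaining_capacity X (D ! k)\<rbrakk>
     \<Longrightarrow> greedy_step X j D (D[k := insert j (D ! k)])"
| open_drone:
    "(\<And>l. l < length D \<Longrightarrow> \<not> feasible X (insert j (D ! l))) \<Longrightarrow> greedy_step X j D (D @ [{j}])"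

inductive greedy_steps :: "ddp \<Rightarrow> nat list \<Rightarrow> nat set list \<Rightarrow> nat set list \<Rightarrow> bool"
  for X :: ddp where
  "greedy_steps X [] D D"
| "\<lbrakk>greedy_step X j D D'; greedy_steps X js D' D''\<rbrakk> \<Longrightarrow> greedy_steps X (j # js) D D''"

definition GreedyAlgoForDDP :: "ddp \<Rightarrow> nat set list \<Rightarrow> bool" where
  "GreedyAlgoForDDP X D \<longleftrightarrow>
     (\<exists>js. distinct js \<and> set js = {..<num_deliveries X} \<and>
           sorted (map (\<lambda>j. tL (deliveries X ! j)) js) \<and> greedy_steps X js [] D)"

section \<open>An implementation with running time\<close>

text \<open>
  A computation carries its result and its number of elementary steps. One step is charged for every
  function call and for every addition, subtraction and comparison of real numbers; the remaining
  operations in the body of a function (constructors, projections, Boolean connectives, case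
  distinctions, incrementing an index) take constant time per call and are covered by the charge for
  the call.
\<close>

datatype 'a timed = Timed (result: 'a) (steps: nat)

definition bind_timed :: "'a timed \<Rightarrow> ('a \<Rightarrow> 'b timed) \<Rightarrow> 'b timed" where
  "bind_timed m f = Timed (result (f (result m))) (steps m + steps (f (result m)))"

adhoc_overloading Monad_Syntax.bind \<rightleftharpoons> bind_timed

definition return :: "'a \<Rightarrow> 'a timed" where
  "return x = Timed x 0"

definition tick :: "'a timed \<Rightarrow> 'a timed" where
  "tick m = Timed (result m) (Suc (steps m))"

definition le_t :: "real \<Rightarrow> real \<Rightarrow> bool timed" where
  "le_t x y = tick (return (x \<le> y))"

definition add_t :: "real \<Rightarrow> real \<Rightarrow> real timed" where
  "add_t x y = tick (return (x + y))"

definition sub_t :: "real \<Rightarrow> real \<Rightarrow> real timed" where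
  "sub_t x y = tick (return (x - y))"

text \<open>Deliveries are paired with their numbers, so that no random access to the input is needed.\<close>

type_synonym job = "nat \<times> delivery"

fun number_t :: "nat \<Rightarrow> delivery list \<Rightarrow> job list timed" where
  "number_t i [] = tick (return [])"
| "number_t i (d # ds) = tick (do {
     js \<leftarrow> number_t (Suc i) ds;
     return ((i, d) # js)
   })"

fun insort_t :: "job \<Rightarrow> job list \<Rightarrow> job list timed" where
  "insort_t x [] = tick (return [x])"
| "insort_t x (y # ys) = tick (do {
     b \<leftarrow> le_t (tL (snd x)) (tL (snd y));
     if b then return (x # y # ys)
     else do {
       zs \<leftarrow> insort_t x ys;
       return (y # zs)
     }
   })"

fun sort_t :: "job list \<Rightarrow> job list timed" where
  "sort_t [] = tick (return [])"
| "sort_t (x # xs) = tick (do {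
     ys \<leftarrow> sort_t xs;
     insort_t x ys
   })"

fun load_t :: "job list \<Rightarrow> real timed" where
  "load_t [] = tick (return 0)"
| "load_t (x # xs) = tick (do {
     s \<leftarrow> load_t xs;
     add_t (cost (snd x)) s
   })"

fun conflict_t :: "job \<Rightarrow> job list \<Rightarrow> bool timed" where
  "conflict_t x [] = tick (return False)"
| "conflict_t x (y # ys) = tick (do {
     a \<leftarrow> le_t (tL (snd x)) (tR (snd y));
     b \<leftarrow> le_t (tL (snd y)) (tR (snd x));
     c \<leftarrow> conflict_t x ys;
     return (a \<and> b \<or> c)
   })"

definition fits_t :: "real \<Rightarrow> job \<Rightarrow> job list \<Rightarrow> bool timed" where
  "fits_t B x xs = tick (do {
     c \<leftarrow> conflict_t x xs;
     s \<leftarrow> load_t xs;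
     s' \<leftarrow> add_t s (cost (snd x));
     b \<leftarrow> le_t s' B;
     return (\<not> c \<and> b)
   })"

text \<open>
  The position, counted from \<open>i\<close>, and the remaining capacity of a drone with maximum remaining
  capacity among those that can take the job \<open>x\<close>.
\<close>

fun best_t :: "real \<Rightarrow> job \<Rightarrow> nat \<Rightarrow> job list list \<Rightarrow> (nat \<times> real) option timed" where
  "best_t B x i [] = tick (return None)"
| "best_t B x i (D # Ds) = tick (do {
     f \<leftarrow> fits_t B x D;
     s \<leftarrow> load_t D;
     r \<leftarrow> sub_t B s;
     m \<leftarrow> best_t B x (Suc i) Ds;
     if f then
       (case m of
          None \<Rightarrow> return (Some (i, r))
        | Some (k, r') \<Rightarrow> do {
            b \<leftarrow> le_t r' r;
            return (if b then Some (i, r) else m)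
          })
     else return m
   })"

fun assign_t :: "nat \<Rightarrow> job \<Rightarrow> job list list \<Rightarrow> job list list timed" where
  "assign_t k x [] = tick (return [])"
| "assign_t 0 x (D # Ds) = tick (return ((x # D) # Ds))"
| "assign_t (Suc k) x (D # Ds) = tick (do {
     Es \<leftarrow> assign_t k x Ds;
     return (D # Es)
   })"

fun open_t :: "job \<Rightarrow> job list list \<Rightarrow> job list list timed" where
  "open_t x [] = tick (return [[x]])"
| "open_t x (D # Ds) = tick (do {
     Es \<leftarrow> open_t x Ds;
     return (D # Es)
   })"

definition place_t :: "real \<Rightarrow> job \<Rightarrow> job list list \<Rightarrow> job list list timed" where
  "place_t B x Ds = tick (do {
     m \<leftarrow> best_t B x 0 Ds;
     (case m of
        None \<Rightarrow> open_t x Ds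
      | Some (k, r) \<Rightarrow> assign_t k x Ds)
   })"

fun process_t :: "real \<Rightarrow> job list \<Rightarrow> job list list \<Rightarrow> job list list timed" where
  "process_t B [] Ds = tick (return Ds)"
| "process_t B (x # xs) Ds = tick (do {
     Es \<leftarrow> place_t B x Ds;
     process_t B xs Es
   })"

definition greedy_t :: "ddp \<Rightarrow> job list list timed" where
  "greedy_t X = tick (do {
     xs \<leftarrow> number_t 0 (deliveries X);
     ys \<leftarrow> sort_t xs;
     process_t (budget X) ys []
   })"

definition assignment :: "job list list \<Rightarrow> nat set list" where
  "assignment Ds = map (\<lambda>D. fst ` set D) Ds"

end

theory Submission
  imports Defs
begin

text \<open>
  Call a drone heavy if its load exceeds half of the budget. The loads of the drones of an optimal
  solution sum up to the total cost, so there are at most \<open>2 OPT\<close> heavy drones. Among the light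
  drones consider the one that was opened last, and the delivery \<open>i\<close> for which it was opened. Every
  other light drone could have taken \<open>i\<close> as far as its capacity is concerned, so it contains a
  delivery whose interval intersects that of \<open>i\<close>. Hence there are at most \<open>\<Delta>\<close> other light drones.
\<close>

section \<open>Feasible sets and partitions\<close>

text \<open>Costs of deliveries are positive. \<open>C\<close> is confined to delivery numbers
  because the sign of \<open>cost (deliveries X ! j)\<close> is known only for indices within the
  list.\<close>

lemma total_cost_mono:
  assumes "ddp_instance X" "A \<subseteq> C" "C \<subseteq> {..<num_deliveries X}"
  shows "total_cost X A \<le> total_cost X C"
  unfolding total_cost_def
proof (rule sum_mono2)
  show "finite C" using assms(3) finite_subset by blast
  show "0 \<le> cost (deliveries X ! j)" if "j \<in> C - A" for j
  proof -
    have "deliveries X ! j \<in> set (deliveries X)"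
      using that assms(3) by (auto simp: num_deliveries_def)
    then show ?thesis using assms(1) by (auto simp: ddp_instance_def less_imp_le)
  qed
qed fact

lemma feasible_subset:
  assumes "ddp_instance X" "feasible X C" "A \<subseteq> C" "C \<subseteq> {..<num_deliveries X}"
  shows "feasible X A"
  using assms total_cost_mono[OF assms(1,3,4)] disjoint_family_on_mono[OF assms(3)]
  by (auto simp: feasible_def)

lemma feasible_singleton:
  assumes "ddp_instance X" "j < num_deliveries X"
  shows "feasible X {j}"
  using assms
  by (auto simp: feasible_def disjoint_family_on_def total_cost_def ddp_instance_def
      num_deliveries_def)

text \<open>Separates the two obstacles to taking \<open>j\<close>: an interval conflict and lack of
  capacity. The bound on light drones rules out the second to obtain the first; the implementation
  tests both.\<close>

lemma feasible_insert_iff: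
  assumes "feasible X A" "finite A" "j \<notin> A"
  shows "feasible X (insert j A) \<longleftrightarrow>
    (\<forall>i\<in>A. interval X j \<inter> interval X i = {}) \<and>
    total_cost X A + cost (deliveries X ! j) \<le> budget X"
  using assms by (auto simp: feasible_def disjoint_family_on_def total_cost_def Int_commute)

section \<open>Lower bound on the optimum by the total cost\<close>

lemma total_cost_partition:
  assumes "partition_on {..<num_deliveries X} P"
  shows "total_cost X {..<num_deliveries X} = (\<Sum>A\<in>P. total_cost X A)"
proof -
  have U: "\<Union>P = {..<num_deliveries X}" and d: "disjoint P"
    using assms by (auto simp: partition_on_def)
  have "finite A" if "A \<in> P" for A
    using that U by (metis Union_upper finite_lessThan finite_subset)
  moreover have "\<forall>A\<in>P. \<forall>A'\<in>P. A \<noteq> A' \<longrightarrow> A \<inter> A' = {}"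
    using d by (auto simp: disjoint_def)
  ultimately show ?thesis
    unfolding total_cost_def U[symmetric] by (subst sum.Union_disjoint) auto
qed

text \<open>The partition into singletons is feasible since every cost is at most the budget, so the
  minimum defining \<open>OPT\<close> ranges over a nonempty set and is attained.\<close>

lemma feasible_partition_OPT:
  assumes "ddp_instance X"
  obtains P where "feasible_partition X P" "card P = OPT X"
proof -
  have "partition_on {..<num_deliveries X} ((\<lambda>j. {j}) ` {..<num_deliveries X})"
    by (auto simp: partition_on_def disjoint_def)
  then have "feasible_partition X ((\<lambda>j. {j}) ` {..<num_deliveries X})"
    using assms feasible_singleton by (auto simp: feasible_partition_def)
  then have "\<exists>k P. feasible_partition X P \<and> card P = k" by blast
  then have "\<exists>P. feasible_partition X P \<and> card P = OPT X"
    unfolding OPT_def by (rule LeastI_ex)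
  then show thesis using that by blast
qed

lemma total_cost_le_OPT:
  assumes "ddp_instance X"
  shows "total_cost X {..<num_deliveries X} \<le> real (OPT X) * budget X"
proof -
  obtain P where P: "feasible_partition X P" "card P = OPT X"
    using feasible_partition_OPT[OF assms] .
  have "total_cost X {..<num_deliveries X} = (\<Sum>A\<in>P. total_cost X A)"
    using P(1) by (auto simp: feasible_partition_def intro: total_cost_partition)
  also have "\<dots> \<le> real (card P) * budget X"
    using P(1) by (intro sum_bounded_above) (auto simp: feasible_partition_def feasible_def)
  finally show ?thesis using P(2) by simp
qed

text \<open>Each heavy set accounts for more than half a budget of the total cost, and the total
  cost is at most \<open>OPT X\<close> budgets. This applies to any feasible partition.\<close>

lemma card_heavy_le:
  assumes X: "ddp_instance X" and P: "feasible_partition X P"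
  shows "card {A \<in> P. budget X / 2 < total_cost X A} \<le> 2 * OPT X"
proof -
  let ?H = "{A \<in> P. budget X / 2 < total_cost X A}"
  have part: "partition_on {..<num_deliveries X} P"
    using P by (simp add: feasible_partition_def)
  then have fin: "finite P" by (rule finite_elements[OF finite_lessThan])
  have nonneg: "0 \<le> total_cost X A" if "A \<in> P" for A
    using total_cost_mono[OF X, of "{}" A] that part
    by (auto simp: partition_on_def total_cost_def)
  have "real (card ?H) * (budget X / 2) \<le> (\<Sum>A\<in>?H. total_cost X A)"
    by (intro sum_bounded_below) auto
  also have "\<dots> \<le> (\<Sum>A\<in>P. total_cost X A)"
    using fin nonneg by (intro sum_mono2) auto
  also have "\<dots> \<le> real (OPT X) * budget X"
    using total_cost_le_OPT[OF X] total_cost_partition[OF part] by simp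
  finally have "real (card ?H) * budget X \<le> real (2 * OPT X) * budget X" by simp
  then have "real (card ?H) \<le> real (2 * OPT X)"
    using X by (simp add: ddp_instance_def)
  then show ?thesis by linarith
qed

section \<open>The number of drones\<close>

text \<open>\<open>S\<close> holds the deliveries processed so far. Disjointness is indexed by
  position, so that two drones cannot share one nonempty set. The last clause speaks of the current
  contents of the earlier drones, not of those at the time drone \<open>k\<close> was
  opened.\<close>

definition greedy_invariant :: "ddp \<Rightarrow> nat set \<Rightarrow> nat set list \<Rightarrow> bool" where
  "greedy_invariant X S D \<longleftrightarrow>
     S \<subseteq> {..<num_deliveries X} \<and> \<Union>(set D) = S \<and>
     disjoint_family_on ((!) D) {..<length D} \<and>
     (\<forall>A\<in>set D. A \<noteq> {} \<and> feasible X A) \<and>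
     (\<forall>k<length D. \<exists>i\<in>D ! k. \<forall>l<k. \<not> feasible X (insert i (D ! l)))"

text \<open>Rejections persist: drones only grow, and feasibility passes to subsets, so a delivery
  once rejected by a drone is rejected by it forever.\<close>

lemma greedy_invariant_step:
  assumes X: "ddp_instance X" and inv: "greedy_invariant X S D"
    and step: "greedy_step X j D D'" and j: "j < num_deliveries X" "j \<notin> S"
  shows "greedy_invariant X (insert j S) D'"
proof -
  from inv have S: "S \<subseteq> {..<num_deliveries X}" and U: "\<Union>(set D) = S"
    and dis: "disjoint_family_on ((!) D) {..<length D}"
    and ok: "\<forall>A\<in>set D. A \<noteq> {} \<and> feasible X A"
    and opener: "\<forall>k<length D. \<exists>i\<in>D ! k. \<forall>l<k. \<not> feasible X (insert i (D ! l))"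
    by (auto simp: greedy_invariant_def)
  have sub: "D ! l \<subseteq> S" if "l < length D" for l using that U nth_mem by blast
  have S': "insert j S \<subseteq> {..<num_deliveries X}" using S j by auto
  show ?thesis using step
  proof cases
    case (assign_drone k)
    have grow: "D ! l \<subseteq> D' ! l" if "l < length D" for l
      using that assign_drone(1) by (cases "l = k") auto
    have len: "length D' = length D" using assign_drone(1) by simp
    have "\<Union>(set D') = insert j S"
    proof -
      have "D' ! l \<subseteq> insert j S" if "l < length D" for l
        using that sub[OF that] sub[OF assign_drone(2)] assign_drone(1) by (cases "l = k") auto
      then have "\<Union>(set D') \<subseteq> insert j S"
        using assign_drone(1) by (metis Union_least in_set_conv_nth length_list_update)
      moreover have "j \<in> D' ! k" "k < length D'" using assign_drone by auto
      then have "j \<in> \<Union>(set D')" using nth_mem by blast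
      moreover have "S \<subseteq> \<Union>(set D')"
      proof
        fix x assume "x \<in> S"
        then obtain l where l: "l < length D" "x \<in> D ! l"
          using U by (auto simp: in_set_conv_nth)
        then have "x \<in> D' ! l" "l < length D'" using grow[of l] len by auto
        then show "x \<in> \<Union>(set D')" using nth_mem by blast
      qed
      ultimately show ?thesis by blast
    qed
    moreover have "D' ! l \<inter> D' ! m = {}" if "l < length D" "m < length D" "l \<noteq> m" for l m
      using that disjoint_family_onD[OF dis, of l m] sub[of l] sub[of m] j(2) assign_drone(1,2)
      by (cases "l = k"; cases "m = k") auto
    then have "disjoint_family_on ((!) D') {..<length D'}"
      using assign_drone(1) by (auto simp: disjoint_family_on_def)
    moreover have "\<forall>A\<in>set D'. A \<noteq> {} \<and> feasible X A"
      using ok assign_drone by (auto dest!: set_update_subset_insert[THEN subsetD])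
    moreover have "\<exists>i\<in>D' ! m. \<forall>l<m. \<not> feasible X (insert i (D' ! l))" if m: "m < length D'" for m
    proof -
      have sub': "D' ! l \<subseteq> insert j S" if "l < length D" for l
        using that len \<open>\<Union>(set D') = insert j S\<close> nth_mem by (metis Union_upper)
      obtain i where i: "i \<in> D ! m" "\<And>l. l < m \<Longrightarrow> \<not> feasible X (insert i (D ! l))"
        using opener m len by auto
      have "\<not> feasible X (insert i (D' ! l))" if l: "l < m" for l
      proof
        assume f: "feasible X (insert i (D' ! l))"
        \<comment> \<open>If \<open>i\<close> fitted the grown drone, it would have fitted its
          smaller predecessor.\<close>
        have "insert i (D ! l) \<subseteq> insert i (D' ! l)"
          using grow[of l] l m len by auto
        moreover have "insert i (D' ! l) \<subseteq> {..<num_deliveries X}"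
          using sub'[of l] S' i(1) sub[of m] l m len by auto
        ultimately show False using feasible_subset[OF X f] i(2)[OF l] by blast
      qed
      then show ?thesis using i(1) grow[of m] m len by auto
    qed
    ultimately show ?thesis using S' by (simp add: greedy_invariant_def)
  next
    case open_drone
    have "j \<notin> D ! l" if "l < length D" for l using sub[OF that] j(2) by blast
    then have "disjoint_family_on ((!) D') {..<length D'}"
      using dis open_drone(1)
      by (auto simp: disjoint_family_on_def nth_append less_Suc_eq)
    \<comment> \<open>For the new drone, at position \<open>length D\<close>, the witness is
      \<open>j\<close> itself: the rule opens a drone only when all existing ones reject
      \<open>j\<close>.\<close>
    moreover have "\<exists>i\<in>D' ! m. \<forall>l<m. \<not> feasible X (insert i (D' ! l))" if "m < length D'" for m
      using that opener open_drone by (cases "m = length D") (auto simp: nth_append)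
    ultimately show ?thesis
      using S' U ok open_drone(1) feasible_singleton[OF X j(1)]
      by (auto simp: greedy_invariant_def)
  qed
qed

lemma greedy_invariant_steps:
  assumes "greedy_steps X js D D'" "ddp_instance X" "greedy_invariant X S D"
    "distinct js" "set js \<subseteq> {..<num_deliveries X}" "set js \<inter> S = {}"
  shows "greedy_invariant X (set js \<union> S) D'"
  using assms
proof (induction arbitrary: S rule: greedy_steps.induct)
  case (1 D)
  then show ?case by simp
next
  case (2 j D D' js D'')
  have "greedy_invariant X (insert j S) D'"
    using greedy_invariant_step[OF 2(4,5,1)] 2 by auto
  then have "greedy_invariant X (set js \<union> insert j S) D''"
    using 2 by (intro "2.IH") auto
  then show ?case by simp
qed

section \<open>Counting light drones by a vertex degree\<close>

lemma degree_le_max_degree: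
  assumes "finite (fst G)" "v \<in> fst G"
  shows "vertex_degree G v \<le> max_degree G"
  using assms by (auto simp: max_degree_def)

lemma finite_interval_graph_edges: "finite (snd (interval_graph X))"
proof (rule finite_subset)
  show "snd (interval_graph X) \<subseteq> Pow {..<num_deliveries X}"
    by (auto simp: interval_graph_def)
qed auto

text \<open>Each light drone other than the last supplies a neighbour of one fixed delivery
  \<open>i\<close>. The neighbours differ because the drones are disjoint, so the degree of
  \<open>i\<close> bounds their number.\<close>

lemma card_light_le:
  assumes X: "ddp_instance X" and inv: "greedy_invariant X S D"
  shows "card {k. k < length D \<and> total_cost X (D ! k) \<le> budget X / 2}
    \<le> max_degree (interval_graph X) + 1"
proof -
  let ?L = "{k. k < length D \<and> total_cost X (D ! k) \<le> budget X / 2}"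
  let ?G = "interval_graph X"
  from inv have S: "S \<subseteq> {..<num_deliveries X}" and U: "\<Union>(set D) = S"
    and dis: "disjoint_family_on ((!) D) {..<length D}"
    and ok: "\<forall>A\<in>set D. A \<noteq> {} \<and> feasible X A"
    and opener: "\<forall>k<length D. \<exists>i\<in>D ! k. \<forall>l<k. \<not> feasible X (insert i (D ! l))"
    by (auto simp: greedy_invariant_def)
  have sub: "D ! l \<subseteq> {..<num_deliveries X}" if "l < length D" for l
    using that U S nth_mem by blast
  show ?thesis
  proof (cases "?L = {}")
    case False
    have fin: "finite ?L" by simp
    \<comment> \<open>The last light drone: all other light drones precede it, hence rejected its
      delivery \<open>i\<close>.\<close>
    define k where "k = Max ?L"
    have k: "k \<in> ?L" unfolding k_def by (rule Max_in[OF fin False])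
    obtain i where i: "i \<in> D ! k" "\<And>l. l < k \<Longrightarrow> \<not> feasible X (insert i (D ! l))"
      using opener k by auto
    have in_n: "i < num_deliveries X" using sub[of k] i(1) k by auto
    \<comment> \<open>\<open>i\<close> alone costs no more than its light drone, thus at most half
      the budget.\<close>
    have "total_cost X {i} \<le> total_cost X (D ! k)"
      using total_cost_mono[OF X, of "{i}" "D ! k"] i(1) sub[of k] k by auto
    then have ci: "cost (deliveries X ! i) \<le> budget X / 2"
      using k by (simp add: total_cost_def)
    have "\<exists>i'. i' \<in> D ! l \<and> interval X i \<inter> interval X i' \<noteq> {}" if l: "l \<in> ?L - {k}" for l
    proof -
      have "l \<le> k" using l fin by (auto simp: k_def)
      then have lk: "l < k" using l by auto
      have "i \<notin> D ! l" using disjoint_family_onD[OF dis, of l k] i(1) l k lk by auto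
      moreover have "finite (D ! l)" using sub[of l] l finite_subset by blast
      moreover have "feasible X (D ! l)" using ok l by auto
      \<comment> \<open>Two halves fit into the budget, so the rejection must come from an interval
        conflict.\<close>
      moreover have "total_cost X (D ! l) + cost (deliveries X ! i) \<le> budget X"
        using ci l by auto
      ultimately show ?thesis using i(2)[OF lk] feasible_insert_iff by blast
    qed
    then have "\<forall>l\<in>?L - {k}. \<exists>i'. i' \<in> D ! l \<and> interval X i \<inter> interval X i' \<noteq> {}" by blast
    from bchoice[OF this] obtain f where f: "\<And>l. l \<in> ?L - {k} \<Longrightarrow> f l \<in> D ! l"
      "\<And>l. l \<in> ?L - {k} \<Longrightarrow> interval X i \<inter> interval X (f l) \<noteq> {}"
      by blast
    have ne: "f l \<noteq> i" if "l \<in> ?L - {k}" for l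
      using disjoint_family_onD[OF dis, of l k] i(1) f(1)[OF that] that k by auto
    have "inj_on (\<lambda>l. {i, f l}) (?L - {k})"
    proof (rule inj_onI)
      fix l m assume l: "l \<in> ?L - {k}" and m: "m \<in> ?L - {k}" and "{i, f l} = {i, f m}"
      then have "f l = f m" using ne[OF l] ne[OF m] by (auto simp: doubleton_eq_iff)
      then show "l = m"
        using f(1)[OF l] f(1)[OF m] l m disjoint_family_onD[OF dis, of l m] by auto
    qed
    moreover have "(\<lambda>l. {i, f l}) ` (?L - {k}) \<subseteq> {e \<in> snd ?G. i \<in> e}"
    proof
      fix e assume "e \<in> (\<lambda>l. {i, f l}) ` (?L - {k})"
      then obtain l where l: "l \<in> ?L - {k}" "e = {i, f l}" by blast
      have "f l < num_deliveries X" using f(1)[OF l(1)] sub[of l] l(1) by auto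
      then show "e \<in> {e \<in> snd ?G. i \<in> e}"
        using l(2) in_n ne[OF l(1)] f(2)[OF l(1)] unfolding interval_graph_def by auto
    qed
    ultimately have "card (?L - {k}) \<le> vertex_degree ?G i"
      unfolding vertex_degree_def using finite_interval_graph_edges[of X]
      by (intro card_inj_on_le) auto
    also have "\<dots> \<le> max_degree ?G"
      using in_n by (intro degree_le_max_degree) (auto simp: interval_graph_def)
    \<comment> \<open>The summand 1 accounts for drone \<open>k\<close> itself.\<close>
    finally show ?thesis using k fin by (simp add: card_Diff_singleton)
  next
    case True
    then show ?thesis by (metis card.empty zero_le)
  qed
qed

text \<open>Distinctness makes \<open>length D\<close> the number of sets in the partition; it
  follows from the sets being nonempty and pairwise disjoint.\<close>

theorem greedy_approximation:
  assumes X: "ddp_instance X" and greedy: "GreedyAlgoForDDP X D"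
  shows "distinct D" "feasible_partition X (set D)"
    "length D \<le> 2 * OPT X + (max_degree (interval_graph X) + 1)"
proof -
  obtain js where js: "distinct js" "set js = {..<num_deliveries X}" "greedy_steps X js [] D"
    using greedy by (auto simp: GreedyAlgoForDDP_def)
  have "greedy_invariant X {} []" by (simp add: greedy_invariant_def disjoint_family_on_def)
  from greedy_invariant_steps[OF js(3) X this js(1)] js(2)
  have inv: "greedy_invariant X {..<num_deliveries X} D" by simp
  then have U: "\<Union>(set D) = {..<num_deliveries X}"
    and dis: "disjoint_family_on ((!) D) {..<length D}"
    and ok: "\<forall>A\<in>set D. A \<noteq> {} \<and> feasible X A"
    by (auto simp: greedy_invariant_def)
  have dis': "D ! k \<inter> D ! l = {}" if "k < length D" "l < length D" "k \<noteq> l" for k l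
    using dis that by (auto simp: disjoint_family_on_def)
  show distinct: "distinct D"
    unfolding distinct_conv_nth using dis' ok by (metis inf.idem nth_mem)
  have "disjoint (set D)"
    unfolding disjoint_def using dis' by (metis in_set_conv_nth)
  then show fp: "feasible_partition X (set D)"
    using U ok by (auto simp: feasible_partition_def partition_on_def)
  let ?H = "{A \<in> set D. budget X / 2 < total_cost X A}"
  let ?L = "{k. k < length D \<and> total_cost X (D ! k) \<le> budget X / 2}"
  \<comment> \<open>Heavy drones are counted as sets, light ones as positions; passing from
    positions to sets cannot increase the count.\<close>
  have split: "set D = ?H \<union> (!) D ` ?L"
    by (force simp: in_set_conv_nth not_less)
  have "card (set D) \<le> card ?H + card ((!) D ` ?L)"
    by (subst split) (rule card_Un_le)
  moreover have "card ((!) D ` ?L) \<le> card ?L" by (rule card_image_le) simp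
  ultimately show "length D \<le> 2 * OPT X + (max_degree (interval_graph X) + 1)"
    using distinct_card[OF distinct] card_heavy_le[OF X fp] card_light_le[OF X inv] by linarith
qed

section \<open>Correctness of the implementation\<close>

lemmas timed_defs = bind_timed_def return_def tick_def le_t_def add_t_def sub_t_def

lemma result_number_t: "result (number_t i ds) = List.enumerate i ds"
  by (induction i ds rule: number_t.induct) (auto simp: timed_defs)

lemma result_sort_t: "result (sort_t xs) = sort_key (\<lambda>x. tL (snd x)) xs"
proof -
  have "result (insort_t x ys) = insort_key (\<lambda>x. tL (snd x)) x ys" for x ys
    by (induction x ys rule: insort_t.induct) (auto simp: timed_defs)
  then show ?thesis by (induction xs rule: sort_t.induct) (auto simp: timed_defs)
qed

lemma result_load_t: "result (load_t xs) = (\<Sum>x\<leftarrow>xs. cost (snd x))"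
  by (induction xs rule: load_t.induct) (auto simp: timed_defs)

lemma result_conflict_t:
  "result (conflict_t x ys) \<longleftrightarrow> (\<exists>y\<in>set ys. tL (snd x) \<le> tR (snd y) \<and> tL (snd y) \<le> tR (snd x))"
  by (induction x ys rule: conflict_t.induct) (auto simp: timed_defs)

lemma result_fits_t:
  "result (fits_t B x xs) \<longleftrightarrow>
    \<not> result (conflict_t x xs) \<and> result (load_t xs) + cost (snd x) \<le> B"
  by (auto simp: fits_t_def timed_defs)

lemma result_assign_t: "k < length Ds \<Longrightarrow> result (assign_t k x Ds) = Ds[k := x # Ds ! k]"
  by (induction k x Ds rule: assign_t.induct) (auto simp: timed_defs)

lemma result_open_t: "result (open_t x Ds) = Ds @ [[x]]"
  by (induction x Ds rule: open_t.induct) (auto simp: timed_defs)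

section \<open>Search for the drone of maximum remaining capacity\<close>

lemma result_best_t_Cons:
  "result (best_t B x i (D # Ds)) =
    (let m = result (best_t B x (Suc i) Ds); r = B - result (load_t D) in
     if result (fits_t B x D) then
       (case m of None \<Rightarrow> Some (i, r) | Some (k, r') \<Rightarrow> if r' \<le> r then Some (i, r) else m)
     else m)"
  by (auto simp: timed_defs Let_def split: option.split)

lemma result_best_t_None:
  "result (best_t B x i Ds) = None \<longleftrightarrow> (\<forall>D\<in>set Ds. \<not> result (fits_t B x D))"
proof (induction Ds arbitrary: i)
  case (Cons D Ds)
  then show ?case
    by (auto simp: result_best_t_Cons Let_def simp del: best_t.simps split: option.split)
qed (simp add: timed_defs)

text \<open>Positions are counted from \<open>i\<close>, so the chosen drone has index
  \<open>k - i\<close> in \<open>Ds\<close>. The induction compares the head with the best drone of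
  the tail.\<close>

lemma result_best_t_Some:
  assumes "result (best_t B x i Ds) = Some (k, r)"
  shows "i \<le> k \<and> k - i < length Ds \<and> result (fits_t B x (Ds ! (k - i))) \<and>
    r = B - result (load_t (Ds ! (k - i))) \<and>
    (\<forall>D\<in>set Ds. result (fits_t B x D) \<longrightarrow> B - result (load_t D) \<le> r)"
  using assms
proof (induction Ds arbitrary: i k r)
  case Nil
  then show ?case by (simp add: timed_defs)
next
  case (Cons D Ds)
  show ?case
  proof (cases "result (best_t B x (Suc i) Ds)")
    case None
    then show ?thesis
      using Cons.prems result_best_t_None[of B x "Suc i" Ds]
      by (auto simp: result_best_t_Cons Let_def simp del: best_t.simps split: if_splits)
  next
    case (Some p)
    obtain k' r' where p: "p = (k', r')" by (cases p)
    have IH: "Suc i \<le> k' \<and> k' - Suc i < length Ds \<and> result (fits_t B x (Ds ! (k' - Suc i))) \<and>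
      r' = B - result (load_t (Ds ! (k' - Suc i))) \<and>
      (\<forall>D\<in>set Ds. result (fits_t B x D) \<longrightarrow> B - result (load_t D) \<le> r')"
      using Cons.IH Some p by simp
    \<comment> \<open>Since \<open>Suc i \<le> k'\<close>, truncated subtraction is exact and the
      index drops by one in the tail.\<close>
    then have nth: "(D # Ds) ! (k' - i) = Ds ! (k' - Suc i)" by (auto simp: nth_Cons')
    show ?thesis
    proof (cases "result (fits_t B x D) \<and> r' \<le> B - result (load_t D)")
      case True
      then have "k = i" "r = B - result (load_t D)"
        using Cons.prems Some p by (auto simp: result_best_t_Cons Let_def simp del: best_t.simps)
      then show ?thesis using True IH by (auto intro: order_trans)
    next
      case False
      \<comment> \<open>Either the head does not fit or its capacity is below \<open>r'\<close>; in
        both cases the tail's choice stands.\<close>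
      then have "k = k'" "r = r'"
        using Cons.prems Some p
        by (auto simp: result_best_t_Cons Let_def simp del: best_t.simps split: if_splits)
      then show ?thesis using False IH nth by auto
    qed
  qed
qed

text \<open>Membership makes the delivery of a job a function of its number, which links lists of
  jobs to sets of numbers.\<close>

definition jobs_of :: "ddp \<Rightarrow> job set" where
  "jobs_of X = (\<lambda>j. (j, deliveries X ! j)) ` {..<num_deliveries X}"

text \<open>The list sum counts repetitions and the set sum does not; distinct numbers make them
  agree.\<close>

lemma load_t_total_cost:
  assumes "set xs \<subseteq> jobs_of X" "distinct (map fst xs)"
  shows "result (load_t xs) = total_cost X (fst ` set xs)"
proof -
  have "snd x = deliveries X ! fst x" if "x \<in> set xs" for x
    using that assms(1) by (auto simp: jobs_of_def)
  then have "(\<Sum>x\<leftarrow>xs. cost (snd x)) = (\<Sum>x\<leftarrow>xs. cost (deliveries X ! fst x))"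
    by (intro arg_cong[of _ _ sum_list] map_cong) auto
  also have "\<dots> = (\<Sum>j\<leftarrow>map fst xs. cost (deliveries X ! j))" by (simp add: comp_def)
  also have "\<dots> = (\<Sum>j\<in>set (map fst xs). cost (deliveries X ! j))"
    by (rule sum_list_distinct_conv_sum_set[OF assms(2)])
  finally show ?thesis by (simp add: result_load_t total_cost_def)
qed

lemma fits_t_feasible:
  assumes X: "ddp_instance X" and xs: "set xs \<subseteq> jobs_of X" "distinct (map fst xs)"
    and x: "x \<in> jobs_of X" "fst x \<notin> fst ` set xs" and f: "feasible X (fst ` set xs)"
  shows "result (fits_t (budget X) x xs) \<longleftrightarrow> feasible X (insert (fst x) (fst ` set xs))"
proof -
  have job: "snd y = deliveries X ! fst y \<and> tL (snd y) \<le> tR (snd y)" if "y \<in> jobs_of X" for y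
    using that X by (auto simp: jobs_of_def ddp_instance_def num_deliveries_def)
  \<comment> \<open>Two nonempty closed intervals meet iff each starts no later than the other
    ends.\<close>
  have "interval X (fst x) \<inter> interval X (fst y) = {} \<longleftrightarrow>
      \<not> (tL (snd x) \<le> tR (snd y) \<and> tL (snd y) \<le> tR (snd x))" if "y \<in> set xs" for y
    using job[OF x(1)] job[OF subsetD[OF xs(1) that]] by (auto simp: interval_def)
  then have "result (conflict_t x xs) \<longleftrightarrow>
      \<not> (\<forall>i\<in>fst ` set xs. interval X (fst x) \<inter> interval X i = {})"
    by (auto simp: result_conflict_t)
  then show ?thesis
    using feasible_insert_iff[OF f _ x(2)] load_t_total_cost[OF xs] job[OF x(1)]
    by (auto simp: result_fits_t)
qed

text \<open>An unsuccessful search is the premise of \<open>open_drone\<close>; a successful one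
  yields a feasible drone of maximum capacity, as \<open>assign_drone\<close> demands.\<close>

lemma place_t_greedy_step:
  assumes X: "ddp_instance X"
    and Ds: "\<And>xs. xs \<in> set Ds \<Longrightarrow> set xs \<subseteq> jobs_of X \<and> distinct (map fst xs) \<and>
      fst x \<notin> fst ` set xs \<and> feasible X (fst ` set xs)"
    and x: "x \<in> jobs_of X"
  shows "greedy_step X (fst x) (assignment Ds) (assignment (result (place_t (budget X) x Ds)))"
proof -
  have fits: "result (fits_t (budget X) x (Ds ! l)) \<longleftrightarrow>
      feasible X (insert (fst x) (assignment Ds ! l))" if "l < length Ds" for l
    using fits_t_feasible[OF X, of "Ds ! l" x] Ds[of "Ds ! l"] x that by (simp add: assignment_def)
  have cap: "remaining_capacity X (assignment Ds ! l) = budget X - result (load_t (Ds ! l))"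
    if "l < length Ds" for l
    using load_t_total_cost[of "Ds ! l" X] Ds[of "Ds ! l"] that
    by (simp add: assignment_def remaining_capacity_def)
  have len: "length (assignment Ds) = length Ds" by (simp add: assignment_def)
  show ?thesis
  proof (cases "result (best_t (budget X) x 0 Ds)")
    case None
    then have "result (place_t (budget X) x Ds) = Ds @ [[x]]"
      by (simp add: place_t_def timed_defs result_open_t)
    then have "assignment (result (place_t (budget X) x Ds)) = assignment Ds @ [{fst x}]"
      by (simp add: assignment_def)
    moreover have "\<not> feasible X (insert (fst x) (assignment Ds ! l))"
      if "l < length (assignment Ds)" for l
      using None that fits len by (simp add: result_best_t_None)
    ultimately show ?thesis using open_drone by metis
  next
    case (Some p)
    obtain k r where p: "p = (k, r)" by (cases p)
    have k: "k < length Ds" "result (fits_t (budget X) x (Ds ! k))"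
      "r = budget X - result (load_t (Ds ! k))"
      "\<And>D. D \<in> set Ds \<Longrightarrow> result (fits_t (budget X) x D) \<Longrightarrow> budget X - result (load_t D) \<le> r"
      using result_best_t_Some[OF Some[unfolded p]] by auto
    have "result (place_t (budget X) x Ds) = Ds[k := x # Ds ! k]"
      using Some p k(1) by (simp add: place_t_def timed_defs result_assign_t)
    then have "assignment (result (place_t (budget X) x Ds)) =
        (assignment Ds)[k := insert (fst x) (assignment Ds ! k)]"
      using k(1) by (simp add: assignment_def map_update)
    moreover have "greedy_step X (fst x) (assignment Ds)
        ((assignment Ds)[k := insert (fst x) (assignment Ds ! k)])"
      using k fits cap len by (intro assign_drone) auto
    ultimately show ?thesis by simp
  qed
qed

text \<open>Records only the shape of the new state, which suffices for both the list invariants and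
  the size bounds of the running time.\<close>

lemma place_t_cases:
  obtains "result (place_t B x Ds) = Ds @ [[x]]"
  | k where "k < length Ds" "result (place_t B x Ds) = Ds[k := x # Ds ! k]"
proof (cases "result (best_t B x 0 Ds)")
  case None
  then show ?thesis using that(1) by (simp add: place_t_def timed_defs result_open_t)
next
  case (Some p)
  obtain k r where p: "p = (k, r)" by (cases p)
  have "k < length Ds" using result_best_t_Some[OF Some[unfolded p]] by auto
  then show ?thesis
    using Some p that(2) by (simp add: place_t_def timed_defs result_assign_t)
qed

text \<open>The greedy invariant is carried along because it supplies the feasibility of the current
  drones, on which the correctness of each test depends.\<close>

lemma process_t_greedy_steps:
  assumes "ddp_instance X" "distinct (map fst xs)" "set xs \<subseteq> jobs_of X"
    "greedy_invariant X S (assignment Ds)" "S \<inter> fst ` set xs = {}"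
    "\<forall>D\<in>set Ds. set D \<subseteq> jobs_of X \<and> distinct (map fst D)"
  shows "greedy_steps X (map fst xs) (assignment Ds)
    (assignment (result (process_t (budget X) xs Ds)))"
  using assms
proof (induction xs arbitrary: S Ds)
  case Nil
  then show ?case by (simp add: timed_defs greedy_steps.intros)
next
  case (Cons x xs)
  note X = Cons.prems(1)
  let ?Es = "result (place_t (budget X) x Ds)"
  have old: "set D \<subseteq> jobs_of X \<and> distinct (map fst D) \<and>
      fst x \<notin> fst ` set D \<and> feasible X (fst ` set D)" if "D \<in> set Ds" for D
  proof -
    have "fst ` set D \<in> set (assignment Ds)" using that by (simp add: assignment_def)
    then have "fst ` set D \<subseteq> S" "feasible X (fst ` set D)"
      using Cons.prems(4) by (auto simp: greedy_invariant_def)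
    then show ?thesis using Cons.prems(5,6) that by auto
  qed
  have x: "x \<in> jobs_of X" "fst x < num_deliveries X" "fst x \<notin> S"
    using Cons.prems(3,5) by (auto simp: jobs_of_def)
  have step: "greedy_step X (fst x) (assignment Ds) (assignment ?Es)"
    using place_t_greedy_step[OF X old x(1)] .
  have inv: "greedy_invariant X (insert (fst x) S) (assignment ?Es)"
    using greedy_invariant_step[OF X Cons.prems(4) step x(2,3)] .
  have new: "\<forall>D\<in>set ?Es. set D \<subseteq> jobs_of X \<and> distinct (map fst D)"
  proof (rule place_t_cases[of "budget X" x Ds])
    assume "?Es = Ds @ [[x]]"
    then show ?thesis using old x by auto
  next
    fix k assume k: "k < length Ds" "?Es = Ds[k := x # Ds ! k]"
    have "set (x # Ds ! k) \<subseteq> jobs_of X \<and> distinct (map fst (x # Ds ! k))"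
      using old[OF nth_mem[OF k(1)]] x(1) by auto
    moreover have "D = x # Ds ! k \<or> D \<in> set Ds" if "D \<in> set ?Es" for D
      using that set_update_subset_insert[of Ds k "x # Ds ! k"] unfolding k(2) by blast
    ultimately show ?thesis using old by metis
  qed
  have "greedy_steps X (map fst xs) (assignment ?Es)
      (assignment (result (process_t (budget X) xs ?Es)))"
    using Cons.prems by (intro Cons.IH[OF X _ _ inv _ new]) auto
  with step show ?case by (auto simp: timed_defs intro: greedy_steps.intros)
qed

theorem greedy_t_correct:
  assumes "ddp_instance X"
  shows "GreedyAlgoForDDP X (assignment (result (greedy_t X)))"
proof -
  define ys where "ys = sort_key (\<lambda>x. tL (snd x)) (List.enumerate 0 (deliveries X))"
  have res: "result (greedy_t X) = result (process_t (budget X) ys [])"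
    by (simp add: greedy_t_def timed_defs result_number_t result_sort_t ys_def)
  have set_ys: "set ys = jobs_of X"
    by (auto simp: ys_def jobs_of_def num_deliveries_def in_set_enumerate_eq image_iff)
  have dist: "distinct (map fst ys)"
  proof -
    \<comment> \<open>Sorting permutes the jobs, so the numbers stay distinct.\<close>
    have "mset (map fst ys) = mset (map fst (List.enumerate 0 (deliveries X)))"
      unfolding ys_def mset_map mset_sort ..
    then show ?thesis by (metis distinct_upt map_fst_enumerate mset_eq_imp_distinct_iff)
  qed
  \<comment> \<open>A job and its number have the same sorting key, so sortedness transfers to the
    list of numbers.\<close>
  have "map (\<lambda>j. tL (deliveries X ! j)) (map fst ys) = map (\<lambda>x. tL (snd x)) ys"
    using set_ys by (auto simp: jobs_of_def)
  then have "sorted (map (\<lambda>j. tL (deliveries X ! j)) (map fst ys))"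
    by (simp only: ys_def sorted_sort_key)
  moreover have "set (map fst ys) = {..<num_deliveries X}"
    using set_ys by (auto simp: jobs_of_def image_iff)
  moreover have "greedy_steps X (map fst ys) [] (assignment (result (greedy_t X)))"
    using process_t_greedy_steps[of X ys "{}" "[]"] assms dist set_ys
    by (simp add: res assignment_def greedy_invariant_def disjoint_family_on_def)
  ultimately show ?thesis using dist unfolding GreedyAlgoForDDP_def by blast
qed

section \<open>Running time of the implementation\<close>

lemma steps_number_t: "steps (number_t i ds) = length ds + 1"
  by (induction i ds rule: number_t.induct) (auto simp: timed_defs)

lemma steps_insort_t: "steps (insort_t x ys) \<le> 2 * length ys + 1"
  by (induction x ys rule: insort_t.induct) (auto simp: timed_defs)

lemma steps_sort_t: "steps (sort_t xs) \<le> length xs * (2 * length xs + 2) + 1"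
proof (induction xs)
  case (Cons x xs)
  have "steps (insort_t x (result (sort_t xs))) \<le> 2 * length xs + 1"
    using steps_insort_t[of x "result (sort_t xs)"] by (simp add: result_sort_t)
  with Cons.IH show ?case by (simp add: timed_defs algebra_simps)
qed (simp add: timed_defs)

lemma steps_load_t: "steps (load_t xs) = 2 * length xs + 1"
  by (induction xs rule: load_t.induct) (auto simp: timed_defs)

lemma steps_conflict_t: "steps (conflict_t x ys) = 3 * length ys + 1"
  by (induction x ys rule: conflict_t.induct) (auto simp: timed_defs)

lemma steps_fits_t: "steps (fits_t B x xs) = 5 * length xs + 5"
  using steps_conflict_t[of x xs] steps_load_t[of xs] by (simp add: fits_t_def timed_defs)

text \<open>The test costs \<open>5 * length D + 5\<close> and the load
  \<open>2 * length D + 1\<close>; the call, the subtraction and at most one comparison add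
  3.\<close>

lemma steps_best_t_Cons:
  "steps (best_t B x i (D # Ds)) \<le> steps (best_t B x (Suc i) Ds) + 7 * length D + 9"
  using steps_fits_t[of B x D] steps_load_t[of D]
  by (auto simp: timed_defs split: option.split)

lemma steps_best_t:
  assumes "\<forall>D\<in>set Ds. length D \<le> m"
  shows "steps (best_t B x i Ds) \<le> length Ds * (7 * m + 9) + 1"
  using assms
proof (induction Ds arbitrary: i)
  case (Cons D Ds)
  have "7 * length D \<le> 7 * m" using Cons.prems by simp
  moreover have "steps (best_t B x (Suc i) Ds) \<le> length Ds * (7 * m + 9) + 1"
    using Cons by simp
  ultimately have "steps (best_t B x i (D # Ds)) \<le> (length Ds * (7 * m + 9) + 1) + 7 * m + 9"
    using steps_best_t_Cons[of B x i D Ds] by linarith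
  then show ?case by (simp add: algebra_simps del: best_t.simps)
qed (simp add: timed_defs)

lemma steps_assign_t: "steps (assign_t k x Ds) \<le> length Ds + 1"
  by (induction k x Ds rule: assign_t.induct) (auto simp: timed_defs)

lemma steps_open_t: "steps (open_t x Ds) = length Ds + 1"
  by (induction x Ds rule: open_t.induct) (auto simp: timed_defs)

lemma steps_place_t:
  assumes "length Ds \<le> m" "\<forall>D\<in>set Ds. length D \<le> m"
  shows "steps (place_t B x Ds) \<le> m * (7 * m + 10) + 3"
proof -
  have "steps (place_t B x Ds) \<le> steps (best_t B x 0 Ds) + length Ds + 2"
    using steps_open_t[of x Ds] steps_assign_t[of _ x Ds]
    by (auto simp: place_t_def timed_defs split: option.split)
  also have "\<dots> \<le> length Ds * (7 * m + 9) + 1 + length Ds + 2"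
    using steps_best_t[OF assms(2), of B x 0] by simp
  \<comment> \<open>Walking to the position of \<open>x\<close> adds one step per drone to the
    search.\<close>
  also have "\<dots> = length Ds * (7 * m + 10) + 3" by (simp add: algebra_simps)
  also have "\<dots> \<le> m * (7 * m + 10) + 3" using assms(1) by (intro add_mono mult_mono) auto
  finally show ?thesis .
qed

text \<open>Placing a job uses up one pending job and lengthens the list of drones, and each drone,
  by at most one. So the sums bounded by \<open>n\<close> never exceed it, and each placement has
  quadratic cost in \<open>n\<close>.\<close>

lemma steps_process_t:
  assumes "length Ds + length xs \<le> n" "\<forall>D\<in>set Ds. length D + length xs \<le> n"
  shows "steps (process_t B xs Ds) \<le> length xs * (n * (7 * n + 10) + 4) + 1"
  using assms
proof (induction xs arbitrary: Ds)
  case Nil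
  then show ?case by (simp add: timed_defs)
next
  case (Cons x xs)
  let ?Es = "result (place_t B x Ds)"
  have "length ?Es + length xs \<le> n \<and> (\<forall>D\<in>set ?Es. length D + length xs \<le> n)"
  proof (rule place_t_cases[of B x Ds])
    assume "?Es = Ds @ [[x]]"
    then show ?thesis using Cons.prems by auto
  next
    fix k assume k: "k < length Ds" "?Es = Ds[k := x # Ds ! k]"
    then have "length (Ds ! k) + length (x # xs) \<le> n" using Cons.prems(2) by simp
    then show ?thesis
      using k Cons.prems by (auto dest!: set_update_subset_insert[THEN subsetD])
  qed
  then have "steps (process_t B xs ?Es) \<le> length xs * (n * (7 * n + 10) + 4) + 1"
    using Cons.IH by blast
  moreover have "steps (place_t B x Ds) \<le> n * (7 * n + 10) + 3"
    using Cons.prems by (intro steps_place_t) auto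
  ultimately show ?case by (simp add: timed_defs)
qed

text \<open>Sorting is quadratic; the cubic term comes from \<open>n\<close> placements of quadratic
  cost. Coefficients are listed from the constant term upwards.\<close>

theorem steps_greedy_t:
  "steps (greedy_t X) \<le> poly [:4, 7, 12, 7:] (num_deliveries X)"
proof -
  let ?n = "num_deliveries X"
  let ?xs = "result (number_t 0 (deliveries X))"
  have len: "length ?xs = ?n" "length (result (sort_t ?xs)) = ?n"
    by (simp_all add: result_number_t result_sort_t num_deliveries_def)
  have "steps (process_t (budget X) (result (sort_t ?xs)) []) \<le> ?n * (?n * (7 * ?n + 10) + 4) + 1"
    using steps_process_t[of "[]" "result (sort_t ?xs)" ?n] len by simp
  moreover have "steps (sort_t ?xs) \<le> ?n * (2 * ?n + 2) + 1"
    using steps_sort_t[of ?xs] len by simp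
  moreover have "steps (number_t 0 (deliveries X)) = ?n + 1"
    by (simp add: steps_number_t num_deliveries_def)
  ultimately have "steps (greedy_t X) \<le>
      (?n + 1) + (?n * (2 * ?n + 2) + 1) + (?n * (?n * (7 * ?n + 10) + 4) + 1) + 1"
    by (simp add: greedy_t_def timed_defs)
  also have "\<dots> = poly [:4, 7, 12, 7:] ?n" by (simp add: algebra_simps)
  finally show ?thesis .
qed

theorem theorem4p3:
  shows "(\<exists>p :: nat poly. \<forall>X. ddp_instance X \<longrightarrow>
            GreedyAlgoForDDP X (assignment (result (greedy_t X))) \<and>
            steps (greedy_t X) \<le> poly p (num_deliveries X)) \<and>
         (\<forall>X D. ddp_instance X \<and> GreedyAlgoForDDP X D \<longrightarrow>
            distinct D \<and> feasible_partition X (set D) \<and>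
            length D \<le> 2 * OPT X + (max_degree (interval_graph X) + 1))"
  \<comment> \<open>The witness for \<open>p\<close> is the cubic of \<open>steps_greedy_t\<close>,
    the same for all instances.\<close>
  using greedy_t_correct steps_greedy_t greedy_approximation by blast

end
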